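(* Let $f:(\mathbb{C}^2,0)\to(\mathbb{C},0)$ be a germ of mixed polynomials such that $\mathcal{N}(f)\subset\mathcal{A}(f)$. Then $\mathcal{A}(f)=N^+$. In particular, if $\mathcal{N}(f)\subset\mathcal{P}(f)$, then $\mathcal{A}(f)=N^+$.
   Context: A germ of mixed polynomials $f:(\mathbb{C}^2,0)\to(\mathbb{C},0)$ is a finite sum $f(z,\bar z)=\sum c_{\nu,\mu}z^{\nu}\bar z^{\mu}$ with $f(0)=0$, where $z=(u,v)$, $\bar z=(\bar u,\bar v)$, $z^\nu=u^{\nu_1}v^{\nu_2}$, $\bar z^\mu=\bar u^{\mu_1}\bar v^{\mu_2}$. The derivatives $f_u,f_{\bar u},f_v,f_{\bar v}$ are the partial derivatives with respect to $u,\bar u,v,\bar v$ treated as independent variables (Wirtinger derivatives). Singular set: $\Sigma_f=\{r_f=0,\ s_f=0\}$, where $r_f=|f_u|^2-|f_{\bar u}|^2+|f_v|^2-|f_{\bar v}|^2$ and $s_f=f_v\overline{f_{\bar u}}-\overline{f_{\bar v}}f_u$; these are again mixed polynomials. ($\Sigma_f$ is the set of critical points of $f$ as a real map $\mathbb{R}^4\to\mathbb{R}^2$.) $N^+$ is the set of vectors $P={}^t(p_1,p_2)$ with $p_1,p_2$ positive integers. For a mixed polynomial $h=\sum c_{\nu,\mu}z^\nu\bar z^\mu$ and $P\in N^+$, the radial degree of $z^\nu\bar z^\mu$ with respect to $P$ is $p_1(\nu_1+\mu_1)+p_2(\nu_2+\mu_2)$, and the face function $h_P$ is the sum of those terms $c_{\nu,\mu}z^\nu\bar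 z^\mu$ ($c_{\nu,\mu}\ne0$) of $h$ whose radial degree with respect to $P$ is minimal. Let $\mathbb{C}^{*2}=(\mathbb{C}\setminus\{0\})^2$. $\mathcal{A}(f)$ is the set of $P={}^t(p_1,p_2)\in N^+$ such that for every real analytic curve of the form $\gamma_P(\tau)=(a_1\tau^{p_1}+\text{h.o.t.},\,b_1\tau^{p_2}+\text{h.o.t.})$, $0<\tau<\delta\ll1$, $(a_1,b_1)\in\mathbb{C}^2$, contained in $\Sigma_f$, one has $a_1=0$ or $b_1=0$. $\mathcal{N}(f)$ is the set of $P\in N^+$ for which $f$ is $\Sigma$-vanished, i.e. $(r_f)_P$ and $(s_f)_P$ have a common root in $\mathbb{C}^{*2}$. $\mathcal{P}(f)$ is the set of $P\in N^+$ for which $f$ is strongly non-degenerate, i.e. the mapping $f_P:\mathbb{C}^{*2}\to\mathbb{C}$ has no critical points (as a real map). *)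

theory Defs
  imports "HOL-Analysis.Analysis" "HOL-Library.Poly_Mapping"
begin

text \<open>
  A mixed polynomial in \<open>z = (u, v)\<close> and its conjugate is a finitely supported family of
  coefficients indexed by pairs \<open>(\<nu>, \<mu>)\<close> of exponent pairs, \<open>\<nu>\<close> for \<open>(u, v)\<close> and \<open>\<mu>\<close> for
  the conjugates.  With componentwise addition on the indices, the library's ring operations
  on finitely supported functions are those of the polynomial ring in the four variables
  \<open>u\<close>, \<open>v\<close> and their conjugates.
\<close>

type_synonym mixed_poly = "((nat \<times> nat) \<times> (nat \<times> nat)) \<Rightarrow>\<^sub>0 complex"

definition mp_eval :: "mixed_poly \<Rightarrow> complex \<times> complex \<Rightarrow> complex" where
  "mp_eval f z = (\<Sum>((a, b), (c, d))\<in>Poly_Mapping.keys f. Poly_Mapping.lookup f ((a, b), (c, d)) *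
     (fst z ^ a * snd z ^ b * cnj (fst z) ^ c * cnj (snd z) ^ d))"

definition mp_cnj :: "mixed_poly \<Rightarrow> mixed_poly" where
  "mp_cnj f = (\<Sum>(\<nu>, \<mu>)\<in>Poly_Mapping.keys f.
     Poly_Mapping.single (\<mu>, \<nu>) (cnj (Poly_Mapping.lookup f (\<nu>, \<mu>))))"

text \<open>
  Wirtinger derivatives; the suffix \<open>c\<close> stands for the derivative with respect to the
  conjugate variable.  Truncated subtraction is harmless: the coefficient then vanishes.
\<close>

definition d_u :: "mixed_poly \<Rightarrow> mixed_poly" where
  "d_u f = (\<Sum>((a, b), (c, d))\<in>Poly_Mapping.keys f.
     Poly_Mapping.single ((a - 1, b), (c, d)) (of_nat a * Poly_Mapping.lookup f ((a, b), (c, d))))"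

definition d_uc :: "mixed_poly \<Rightarrow> mixed_poly" where
  "d_uc f = (\<Sum>((a, b), (c, d))\<in>Poly_Mapping.keys f.
     Poly_Mapping.single ((a, b), (c - 1, d)) (of_nat c * Poly_Mapping.lookup f ((a, b), (c, d))))"

definition d_v :: "mixed_poly \<Rightarrow> mixed_poly" where
  "d_v f = (\<Sum>((a, b), (c, d))\<in>Poly_Mapping.keys f.
     Poly_Mapping.single ((a, b - 1), (c, d)) (of_nat b * Poly_Mapping.lookup f ((a, b), (c, d))))"

definition d_vc :: "mixed_poly \<Rightarrow> mixed_poly" where
  "d_vc f = (\<Sum>((a, b), (c, d))\<in>Poly_Mapping.keys f.
     Poly_Mapping.single ((a, b), (c, d - 1)) (of_nat d * Poly_Mapping.lookup f ((a, b), (c, d))))"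

text \<open>
  These have to be mixed polynomials rather than functions, since their face functions are
  needed; the squared modulus of \<open>h\<close> is \<open>h * mp_cnj h\<close>.
\<close>

definition r_poly :: "mixed_poly \<Rightarrow> mixed_poly" where
  "r_poly f = d_u f * mp_cnj (d_u f) - d_uc f * mp_cnj (d_uc f)
            + d_v f * mp_cnj (d_v f) - d_vc f * mp_cnj (d_vc f)"

definition s_poly :: "mixed_poly \<Rightarrow> mixed_poly" where
  "s_poly f = d_v f * mp_cnj (d_uc f) - mp_cnj (d_vc f) * d_u f"

definition Sing :: "mixed_poly \<Rightarrow> (complex \<times> complex) set" where
  "Sing f = {z. mp_eval (r_poly f) z = 0 \<and> mp_eval (s_poly f) z = 0}"

definition Nplus :: "(nat \<times> nat) set" where
  "Nplus = {(p1, p2). 0 < p1 \<and> 0 < p2}"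

fun rdeg :: "nat \<times> nat \<Rightarrow> (nat \<times> nat) \<times> (nat \<times> nat) \<Rightarrow> nat" where
  "rdeg (p1, p2) ((a, b), (c, d)) = p1 * (a + c) + p2 * (b + d)"

definition face :: "nat \<times> nat \<Rightarrow> mixed_poly \<Rightarrow> mixed_poly" where
  "face P h = (\<Sum>k\<in>{k \<in> Poly_Mapping.keys h. \<forall>k'\<in>Poly_Mapping.keys h. rdeg P k \<le> rdeg P k'}.
     Poly_Mapping.single k (Poly_Mapping.lookup h k))"

definition Cstar2 :: "(complex \<times> complex) set" where
  "Cstar2 = (UNIV - {0}) \<times> (UNIV - {0})"

text \<open>
  A curve germ with weight \<open>(p1, p2)\<close> is given by two convergent power series \<open>F\<close>, \<open>G\<close> in the
  real parameter \<open>\<tau>\<close>, starting in degree \<open>p1\<close>, \<open>p2\<close> respectively; the coefficients in these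
  degrees are \<open>a\<^sub>1\<close> and \<open>b\<^sub>1\<close> and may be zero.
\<close>

definition curve_in_Sing :: "mixed_poly \<Rightarrow> nat \<times> nat \<Rightarrow> complex fps \<Rightarrow> complex fps \<Rightarrow> bool" where
  "curve_in_Sing f P F G \<longleftrightarrow>
     (\<forall>i<fst P. fps_nth F i = 0) \<and> (\<forall>i<snd P. fps_nth G i = 0) \<and>
     (\<exists>\<delta>>0. ereal \<delta> \<le> fps_conv_radius F \<and> ereal \<delta> \<le> fps_conv_radius G \<and>
        (\<forall>\<tau>. 0 < \<tau> \<and> \<tau> < \<delta> \<longrightarrow> (eval_fps F (of_real \<tau>), eval_fps G (of_real \<tau>)) \<in> Sing f))"

definition A_set :: "mixed_poly \<Rightarrow> (nat \<times> nat) set" where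
  "A_set f = {P \<in> Nplus. \<forall>F G. curve_in_Sing f P F G \<longrightarrow>
     fps_nth F (fst P) = 0 \<or> fps_nth G (snd P) = 0}"

definition N_set :: "mixed_poly \<Rightarrow> (nat \<times> nat) set" where
  "N_set f = {P \<in> Nplus. \<exists>z\<in>Cstar2.
     mp_eval (face P (r_poly f)) z = 0 \<and> mp_eval (face P (s_poly f)) z = 0}"

text \<open>
  \<open>critical_point\<close> refers to the real Frechet derivative: the real linear map between
  real vector spaces of dimension 4 and 2 has rank less than 2.
\<close>

definition critical_point :: "(complex \<times> complex \<Rightarrow> complex) \<Rightarrow> complex \<times> complex \<Rightarrow> bool" where
  "critical_point g z \<longleftrightarrow> (\<exists>D. (g has_derivative D) (at z) \<and> \<not> surj D)"

definition P_set :: "mixed_poly \<Rightarrow> (nat \<times> nat) set" where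
  "P_set f = {P \<in> Nplus. \<forall>z\<in>Cstar2. \<not> critical_point (mp_eval (face P f)) z}"

lemma mp_eval_single:
  "mp_eval (Poly_Mapping.single ((a, b), (c, d)) x) z =
     x * (fst z ^ a * snd z ^ b * cnj (fst z) ^ c * cnj (snd z) ^ d)"
  by (cases "x = 0") (auto simp: mp_eval_def)

lemma mp_eval_single':
  "mp_eval (Poly_Mapping.single k x) z = x * (fst z ^ fst (fst k) * snd z ^ snd (fst k) *
     cnj (fst z) ^ fst (snd k) * cnj (snd z) ^ snd (snd k))"
  by (cases "x = 0") (auto simp: mp_eval_def case_prod_unfold)

lemma mp_eval_0 [simp]: "mp_eval 0 z = 0"
  by (simp add: mp_eval_def)

lemma mp_eval_add: "mp_eval (f + g) z = mp_eval f z + mp_eval g z"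
  unfolding mp_eval_def case_prod_unfold prod.collapse
  by (rule setsum_keys_plus_distrib) (auto simp: algebra_simps)

lemma mp_eval_diff: "mp_eval (f - g) z = mp_eval f z - mp_eval g z"
  using mp_eval_add[of "f - g" g z] by simp

lemma mp_eval_sum: "mp_eval (sum g I) z = (\<Sum>i\<in>I. mp_eval (g i) z)"
  by (induction I rule: infinite_finite_induct) (auto simp: mp_eval_add)

lemma mp_sum_singles:
  fixes f :: mixed_poly
  shows "(\<Sum>k\<in>Poly_Mapping.keys f. Poly_Mapping.single k (Poly_Mapping.lookup f k)) = f"
  by (rule poly_mapping_eqI) (auto simp: lookup_sum lookup_single when_def in_keys_iff)

lemma mp_eval_mult: "mp_eval (f * g) z = mp_eval f z * mp_eval g z"
proof -
  have s: "mp_eval (Poly_Mapping.single k x * Poly_Mapping.single l y) z =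
      mp_eval (Poly_Mapping.single k x) z * mp_eval (Poly_Mapping.single l y) z" for k l x y
  proof -
    obtain a b c d where k: "k = ((a, b), (c, d))" by (metis surj_pair)
    obtain a' b' c' d' where l: "l = ((a', b'), (c', d'))" by (metis surj_pair)
    show ?thesis
      by (simp add: k l mult_single mp_eval_single power_add mult_ac)
  qed
  let ?S = "\<lambda>f. \<Sum>k\<in>Poly_Mapping.keys f. Poly_Mapping.single k (Poly_Mapping.lookup f k)"
  have "mp_eval (?S f * ?S g) z = mp_eval (?S f) z * mp_eval (?S g) z"
    by (simp add: sum_product mp_eval_sum s)
  then show ?thesis by (simp only: mp_sum_singles)
qed

lemma mp_eval_cnj: "mp_eval (mp_cnj f) z = cnj (mp_eval f z)"
  unfolding mp_cnj_def mp_eval_sum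
  by (auto simp: mp_eval_single mp_eval_def[of f] mult_ac intro!: sum.cong)

lemma mp_has_derivative:
  "(mp_eval f has_derivative (\<lambda>h.
      mp_eval (d_u f) z * fst h + mp_eval (d_uc f) z * cnj (fst h) +
      mp_eval (d_v f) z * snd h + mp_eval (d_vc f) z * cnj (snd h))) (at z)"
proof -
  let ?l = "Poly_Mapping.lookup f"
  have 1: "((\<lambda>z. \<Sum>((a, b), (c, d))\<in>Poly_Mapping.keys f. ?l ((a, b), (c, d)) *
       (fst z ^ a * snd z ^ b * cnj (fst z) ^ c * cnj (snd z) ^ d)) has_derivative
    (\<lambda>h. \<Sum>((a, b), (c, d))\<in>Poly_Mapping.keys f.
        of_nat a * ?l ((a, b), (c, d)) * (fst z ^ (a - 1) * snd z ^ b * cnj (fst z) ^ c * cnj (snd z) ^ d) * fst h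
      + of_nat c * ?l ((a, b), (c, d)) * (fst z ^ a * snd z ^ b * cnj (fst z) ^ (c - 1) * cnj (snd z) ^ d) * cnj (fst h)
      + of_nat b * ?l ((a, b), (c, d)) * (fst z ^ a * snd z ^ (b - 1) * cnj (fst z) ^ c * cnj (snd z) ^ d) * snd h
      + of_nat d * ?l ((a, b), (c, d)) * (fst z ^ a * snd z ^ b * cnj (fst z) ^ c * cnj (snd z) ^ (d - 1)) * cnj (snd h)))
    (at z)"
    unfolding case_prod_unfold
    by (rule has_derivative_sum, rule has_derivative_eq_rhs, (rule derivative_intros)+)
       (simp add: algebra_simps)
  have 2: "mp_eval f = (\<lambda>z. \<Sum>((a, b), (c, d))\<in>Poly_Mapping.keys f. ?l ((a, b), (c, d)) *
       (fst z ^ a * snd z ^ b * cnj (fst z) ^ c * cnj (snd z) ^ d))"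
    by (simp add: fun_eq_iff mp_eval_def)
  show ?thesis
    unfolding 2 d_u_def d_uc_def d_v_def d_vc_def mp_eval_sum
    using 1
    by (simp add: case_prod_unfold mp_eval_single' sum.distrib sum_distrib_right)
qed

end

theory Submission
  imports Defs
begin

text \<open>
  Both parts follow from one principle: along a curve with leading terms \<open>a \<tau>\<^bsup>p\<^sub>1\<^esup>\<close> and
  \<open>b \<tau>\<^bsup>p\<^sub>2\<^esup>\<close>, a term of radial degree \<open>m\<close> is of order \<open>\<tau>\<^sup>m\<close>, so that after division by
  the least power of \<open>\<tau>\<close> a mixed polynomial tends to the value of its face function at
  \<open>(a, b)\<close> (lemma \<open>face_limit\<close>).

  If the curve lies in \<open>Sing f\<close>, applying this to \<open>r_poly f\<close> and \<open>s_poly f\<close> shows that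
  \<open>(a, b)\<close> is a common root of their face functions.  Hence a vector \<open>P\<close> of \<open>Nplus\<close> outside \<open>N_set f\<close>
  belongs to \<open>A_set f\<close>, and the first part follows.

  For the second part it is enough that \<open>P_set f \<subseteq> A_set f\<close>, that is, that \<open>(a, b)\<close> is a
  critical point of the face function of \<open>f\<close> whenever \<open>a\<close> and \<open>b\<close> are nonzero.  Passing to
  the limit in \<open>r_f = 0\<close> is not good enough for this: if \<open>p\<^sub>1 \<noteq> p\<^sub>2\<close>, the summands of \<open>r_f\<close> that come from
  \<open>u\<close> and from \<open>v\<close> have different weights, so the leading term of \<open>r_f\<close> may see only one of
  the two pairs.  However, \<open>r_f = s_f = 0\<close> says that the vectors
  \<open>(cnj f\<^sub>u, cnj f\<^sub>v)\<close> and \<open>(f\<^sub>u\<^sub>c, f\<^sub>v\<^sub>c)\<close> are linearly dependent and have the same length,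
  hence differ by a factor of modulus 1; so \<open>\<bar>f\<^sub>u\<bar> = \<bar>f\<^sub>u\<^sub>c\<bar>\<close> and \<open>\<bar>f\<^sub>v\<bar> = \<bar>f\<^sub>v\<^sub>c\<bar>\<close> hold
  separately.  Each of these equations is homogeneous, and therefore survives in the limit.
  There the derivatives are taken in the Euler form \<open>u f\<^sub>u\<close>, whose terms have the same
  radial degrees as those of \<open>f\<close>.
\<close>

section \<open>Monomials and weighted sums of terms\<close>

definition mono_eval :: "(nat \<times> nat) \<times> (nat \<times> nat) \<Rightarrow> complex \<times> complex \<Rightarrow> complex" where
  "mono_eval k z = fst z ^ fst (fst k) * snd z ^ snd (fst k) *
     cnj (fst z) ^ fst (snd k) * cnj (snd z) ^ snd (snd k)"

text \<open>
  The weight \<open>w\<close> makes the evaluation of \<open>f\<close> and of its Euler derivatives (\<open>euler_derivatives\<close>)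
  instances of one operation that does not move terms to other exponents.
\<close>

definition weighted_eval ::
    "((nat \<times> nat) \<times> (nat \<times> nat) \<Rightarrow> nat) \<Rightarrow> mixed_poly \<Rightarrow> complex \<times> complex \<Rightarrow> complex" where
  "weighted_eval w f z =
     (\<Sum>k\<in>Poly_Mapping.keys f. of_nat (w k) * Poly_Mapping.lookup f k * mono_eval k z)"

lemma weighted_eval_one: "weighted_eval (\<lambda>k. 1) f z = mp_eval f z"
  by (simp add: weighted_eval_def mp_eval_def mono_eval_def case_prod_unfold)

lemma euler_derivatives:
  "fst z * mp_eval (d_u f) z = weighted_eval (\<lambda>k. fst (fst k)) f z"
  "cnj (fst z) * mp_eval (d_uc f) z = weighted_eval (\<lambda>k. fst (snd k)) f z"
  "snd z * mp_eval (d_v f) z = weighted_eval (\<lambda>k. snd (fst k)) f z"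
  "cnj (snd z) * mp_eval (d_vc f) z = weighted_eval (\<lambda>k. snd (snd k)) f z"
  unfolding weighted_eval_def d_u_def d_uc_def d_v_def d_vc_def mp_eval_sum sum_distrib_left
  by (auto intro!: sum.cong simp: mono_eval_def mp_eval_single split: nat_diff_split)

section \<open>Face functions as limits along curves\<close>

lemma mono_eval_scale:
  "mono_eval k (of_real t ^ fst P * x, of_real t ^ snd P * y) =
     of_real t ^ rdeg P k * mono_eval k (x, y)"
proof -
  obtain p1 p2 a b c d where "P = (p1, p2)" "k = ((a, b), (c, d))"
    by (metis surj_pair)
  then show ?thesis
    by (simp add: mono_eval_def power_mult_distrib power_add power_mult distrib_left)
qed

lemma lookup_face:
  "Poly_Mapping.lookup (face P h) k =
     (if \<forall>k'\<in>Poly_Mapping.keys h. rdeg P k \<le> rdeg P k' then Poly_Mapping.lookup h k else 0)"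
  by (auto simp: face_def lookup_sum lookup_single when_def in_keys_iff)

text \<open>
  The exponent \<open>m\<close> depends on the mixed polynomial only: equations between several weighted
  sums of the same polynomial pass to the limit together.
\<close>

lemma face_limit:
  assumes x: "((\<lambda>t. x t / of_real t ^ fst P) \<longlongrightarrow> a) (at_right 0)"
    and y: "((\<lambda>t. y t / of_real t ^ snd P) \<longlongrightarrow> b) (at_right (0::real))"
  shows "\<exists>m. \<forall>w. ((\<lambda>t. weighted_eval w h (x t, y t) / of_real t ^ m) \<longlongrightarrow>
           weighted_eval w (face P h) (a, b)) (at_right 0)"
proof (cases "h = 0")
  case True
  then show ?thesis by (simp add: weighted_eval_def face_def)
next
  case False
  let ?K = "Poly_Mapping.keys h"
  define m where "m = Min (rdeg P ` ?K)"
  have m_le: "m \<le> rdeg P k" if "k \<in> ?K" for k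
    using that by (simp add: m_def)
  have minimal: "(\<forall>k'\<in>?K. rdeg P k \<le> rdeg P k') \<longleftrightarrow> rdeg P k = m" if "k \<in> ?K" for k
    using that False by (auto simp: m_def intro!: Min_eqI[symmetric] Min_le)
  have "((\<lambda>t. weighted_eval w h (x t, y t) / of_real t ^ m) \<longlongrightarrow>
          weighted_eval w (face P h) (a, b)) (at_right 0)" for w
  proof -
    let ?c = "\<lambda>k. of_nat (w k) * Poly_Mapping.lookup h k"
    let ?z = "\<lambda>t. (x t / of_real t ^ fst P, y t / of_real t ^ snd P)"
    have lim: "((\<lambda>t. \<Sum>k\<in>?K. ?c k * (of_real t ^ (rdeg P k - m) * mono_eval k (?z t))) \<longlongrightarrow>
        (\<Sum>k\<in>?K. ?c k * (of_real 0 ^ (rdeg P k - m) * mono_eval k (a, b)))) (at_right 0)"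
      unfolding mono_eval_def fst_conv snd_conv
      by (intro tendsto_intros x y)
    have face: "(\<Sum>k\<in>?K. ?c k * (of_real 0 ^ (rdeg P k - m) * mono_eval k (a, b))) =
        weighted_eval w (face P h) (a, b)"
      unfolding weighted_eval_def
    proof (rule sum.mono_neutral_cong_right)
      show "Poly_Mapping.keys (face P h) \<subseteq> ?K"
        by (auto simp: in_keys_iff lookup_face split: if_splits)
      show "\<forall>k\<in>?K - Poly_Mapping.keys (face P h).
          ?c k * (of_real 0 ^ (rdeg P k - m) * mono_eval k (a, b)) = 0"
      proof
        fix k assume k: "k \<in> ?K - Poly_Mapping.keys (face P h)"
        then have "\<not> (\<forall>k'\<in>?K. rdeg P k \<le> rdeg P k')"
          by (simp add: in_keys_iff lookup_face split: if_splits)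
        then have "m < rdeg P k"
          using k minimal m_le by (metis DiffD1 le_neq_implies_less)
        then show "?c k * (of_real 0 ^ (rdeg P k - m) * mono_eval k (a, b)) = 0"
          by simp
      qed
      show "?c k * (of_real 0 ^ (rdeg P k - m) * mono_eval k (a, b)) =
          of_nat (w k) * Poly_Mapping.lookup (face P h) k * mono_eval k (a, b)"
        if "k \<in> Poly_Mapping.keys (face P h)" for k
      proof -
        have "k \<in> ?K" and least: "\<forall>k'\<in>?K. rdeg P k \<le> rdeg P k'"
          using that by (auto simp: in_keys_iff lookup_face split: if_splits)
        then have "rdeg P k = m" by (simp only: minimal)
        then show ?thesis using least by (simp add: lookup_face)
      qed
    qed simp
    have "\<forall>\<^sub>F t in at_right 0.
        (\<Sum>k\<in>?K. ?c k * (of_real t ^ (rdeg P k - m) * mono_eval k (?z t))) =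
        weighted_eval w h (x t, y t) / of_real t ^ m"
      using eventually_at_right_less
    proof eventually_elim
      case (elim t)
      have "mono_eval k (x t, y t) / of_real t ^ m =
          of_real t ^ (rdeg P k - m) * mono_eval k (?z t)" if "k \<in> ?K" for k
        using mono_eval_scale[of k t P "fst (?z t)" "snd (?z t)"] elim m_le[OF that]
        by (simp add: power_diff)
      then show ?case
        by (simp add: weighted_eval_def sum_divide_distrib mult.assoc
            flip: times_divide_eq_right cong: sum.cong)
    qed
    from Lim_transform_eventually[OF lim this] show ?thesis
      by (simp only: face)
  qed
  then show ?thesis by blast
qed

lemma eval_fps_leading_coeff:
  fixes F :: "complex fps"
  assumes "\<forall>i<p. fps_nth F i = 0" and "0 < fps_conv_radius F"
  shows "((\<lambda>t. eval_fps F (of_real t) / of_real t ^ p) \<longlongrightarrow> fps_nth F p) (at_right (0::real))"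
proof -
  define G where "G = fps_shift p F"
  have F: "F = fps_X ^ p * G"
    using assms(1) by (intro fps_ext) (auto simp: G_def fps_X_power_mult_nth)
  have rad: "0 < fps_conv_radius G"
    using assms(2) by (simp add: G_def)
  have "isCont (eval_fps G) 0"
    using rad by (intro continuous_eval_fps) (auto simp: zero_ereal_def)
  moreover have "((\<lambda>t. of_real t :: complex) \<longlongrightarrow> 0) (at_right (0::real))"
    by (rule tendsto_eq_intros) auto
  ultimately have lim: "((\<lambda>t. eval_fps G (of_real t)) \<longlongrightarrow> eval_fps G 0) (at_right (0::real))"
    by (rule isCont_tendsto_compose)
  have at_0: "eval_fps G 0 = fps_nth F p"
    by (simp add: eval_fps_at_0 G_def)
  have "\<forall>\<^sub>F t in at_right (0::real).
      eval_fps G (of_real t) = eval_fps F (of_real t) / of_real t ^ p"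
  proof -
    obtain e where e: "0 < e" "ereal e < fps_conv_radius G"
      using rad by (metis ereal_dense2 ereal_less(2))
    have "\<forall>\<^sub>F t in at_right (0::real). t \<in> {0<..<e}"
      using e by (intro eventually_at_right_real)
    then show ?thesis
    proof eventually_elim
      case (elim t)
      then have "ereal (norm (of_real t :: complex)) < fps_conv_radius G"
        using e by (auto intro: less_trans[OF _ e(2)])
      then have "eval_fps F (of_real t) = of_real t ^ p * eval_fps G (of_real t)"
        unfolding F by (subst eval_fps_mult) (auto simp: fps_conv_radius_fps_X_power)
      then show ?case using elim by simp
    qed
  qed
  from Lim_transform_eventually[OF lim this] show ?thesis
    by (simp only: at_0)
qed

lemma curve_in_Sing_limits:
  assumes "curve_in_Sing f P F G"
  defines "\<gamma> \<equiv> \<lambda>t::real. (eval_fps F (of_real t), eval_fps G (of_real t))"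
  shows "((\<lambda>t. fst (\<gamma> t) / of_real t ^ fst P) \<longlongrightarrow> fps_nth F (fst P)) (at_right 0)"
    and "((\<lambda>t. snd (\<gamma> t) / of_real t ^ snd P) \<longlongrightarrow> fps_nth G (snd P)) (at_right 0)"
    and "\<forall>\<^sub>F t in at_right 0. \<gamma> t \<in> Sing f"
proof -
  obtain \<delta> where \<delta>: "0 < \<delta>" "ereal \<delta> \<le> fps_conv_radius F" "ereal \<delta> \<le> fps_conv_radius G"
    "\<And>t. 0 < t \<Longrightarrow> t < \<delta> \<Longrightarrow> \<gamma> t \<in> Sing f"
    using assms unfolding curve_in_Sing_def by blast
  have "0 < fps_conv_radius F" "0 < fps_conv_radius G"
    using \<delta>(1-3) by (auto intro: less_le_trans[of _ "ereal \<delta>"])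
  then show "((\<lambda>t. fst (\<gamma> t) / of_real t ^ fst P) \<longlongrightarrow> fps_nth F (fst P)) (at_right 0)"
    and "((\<lambda>t. snd (\<gamma> t) / of_real t ^ snd P) \<longlongrightarrow> fps_nth G (snd P)) (at_right 0)"
    using assms(1) unfolding curve_in_Sing_def \<gamma>_def
    by (auto intro: eval_fps_leading_coeff)
  show "\<forall>\<^sub>F t in at_right 0. \<gamma> t \<in> Sing f"
    using eventually_at_right_real[OF \<delta>(1)] by eventually_elim (auto intro: \<delta>(4))
qed

section \<open>Vectors at which the singular set does not vanish to leading order\<close>

lemma face_root_of_vanishing_along_curve:
  assumes "((\<lambda>t. fst (\<gamma> t) / of_real t ^ fst P) \<longlongrightarrow> a) (at_right 0)"
    and "((\<lambda>t. snd (\<gamma> t) / of_real t ^ snd P) \<longlongrightarrow> b) (at_right (0::real))"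
    and zero: "\<forall>\<^sub>F t in at_right 0. mp_eval h (\<gamma> t) = 0"
  shows "mp_eval (face P h) (a, b) = 0"
proof -
  obtain m where m: "((\<lambda>t. mp_eval h (\<gamma> t) / of_real t ^ m) \<longlongrightarrow>
      mp_eval (face P h) (a, b)) (at_right 0)"
    using face_limit[OF assms(1,2), of h] unfolding weighted_eval_one[symmetric] by auto
  have "\<forall>\<^sub>F t in at_right 0. mp_eval h (\<gamma> t) / of_real t ^ m = 0"
    using zero by eventually_elim simp
  then have "((\<lambda>t. 0) \<longlongrightarrow> mp_eval (face P h) (a, b)) (at_right (0::real))"
    by (rule Lim_transform_eventually[OF m])
  then show ?thesis
    by (simp add: tendsto_const_iff)
qed

lemma Nplus_diff_N_set_subset_A_set: "Nplus - N_set f \<subseteq> A_set f"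
proof (rule subsetI, rule ccontr)
  fix P assume P: "P \<in> Nplus - N_set f" "P \<notin> A_set f"
  then obtain F G where curve: "curve_in_Sing f P F G"
    and nz: "fps_nth F (fst P) \<noteq> 0" "fps_nth G (snd P) \<noteq> 0"
    by (auto simp: A_set_def)
  let ?z = "(fps_nth F (fst P), fps_nth G (snd P))"
  note lim = curve_in_Sing_limits[OF curve]
  have "mp_eval (face P (r_poly f)) ?z = 0" "mp_eval (face P (s_poly f)) ?z = 0"
    by (rule face_root_of_vanishing_along_curve[OF lim(1,2)];
        use lim(3) in \<open>eventually_elim, simp add: Sing_def\<close>)+
  moreover have "?z \<in> Cstar2"
    using nz by (simp add: Cstar2_def)
  ultimately show False
    using P by (auto simp: N_set_def)
qed

section \<open>Critical points in terms of Wirtinger derivatives\<close>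

text \<open>
  This says that \<open>(cnj A, cnj C) = \<lambda> (B, D)\<close> for some \<open>\<lambda>\<close> with \<open>\<bar>\<lambda>\<bar> = 1\<close>, written by
  equations between continuous functions so that the condition is visibly closed.
\<close>

definition rank_deficient :: "complex \<Rightarrow> complex \<Rightarrow> complex \<Rightarrow> complex \<Rightarrow> bool" where
  "rank_deficient A B C D \<longleftrightarrow> norm A = norm B \<and> norm C = norm D \<and> C * cnj B = cnj D * A"

text \<open>
  Multiplying \<open>\<bar>A\<bar>\<^sup>2 + \<bar>C\<bar>\<^sup>2 = \<bar>B\<bar>\<^sup>2 + \<bar>D\<bar>\<^sup>2\<close> by \<open>\<bar>B\<bar>\<^sup>2\<close> and using \<open>\<bar>C\<bar> \<bar>B\<bar> = \<bar>D\<bar> \<bar>A\<bar>\<close> gives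
  \<open>(\<bar>A\<bar>\<^sup>2 - \<bar>B\<bar>\<^sup>2) (\<bar>B\<bar>\<^sup>2 + \<bar>D\<bar>\<^sup>2) = 0\<close>.
\<close>

lemma rank_deficientI:
  assumes r: "A * cnj A - B * cnj B + C * cnj C - D * cnj D = 0"
    and s: "C * cnj B - cnj D * A = 0"
  shows "rank_deficient A B C D"
proof -
  let ?a = "(norm A)\<^sup>2" and ?b = "(norm B)\<^sup>2" and ?c = "(norm C)\<^sup>2" and ?d = "(norm D)\<^sup>2"
  have "complex_of_real (?a - ?b + ?c - ?d) = 0"
    using r by (simp only: of_real_diff of_real_add complex_norm_square)
  then have sum: "?a + ?c = ?b + ?d"
    by (simp only: of_real_eq_0_iff)
  have "norm (C * cnj B) = norm (cnj D * A)"
    using s by simp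
  then have "norm C * norm B = norm D * norm A"
    by (simp only: norm_mult complex_mod_cnj)
  then have "?c * ?b = ?d * ?a"
    by (metis power_mult_distrib)
  with sum have "(?a - ?b) * (?b + ?d) = 0"
    by algebra
  then have "?a = ?b"
  proof (cases "?b + ?d = 0")
    case True
    then have "?b = 0 \<and> ?d = 0" by (simp add: add_nonneg_eq_0_iff)
    moreover have "?a = 0 \<and> ?c = 0"
      using sum True by (simp add: add_nonneg_eq_0_iff)
    ultimately show ?thesis by simp
  qed auto
  with sum have "norm A = norm B" "norm C = norm D"
    by simp_all
  with s show ?thesis by (simp add: rank_deficient_def)
qed

lemma rank_deficient_mult:
  assumes "c \<noteq> 0" "d \<noteq> 0"
  shows "rank_deficient (c * A) (cnj c * B) (d * C) (cnj d * D) \<longleftrightarrow> rank_deficient A B C D"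
  using assms by (auto simp: rank_deficient_def norm_mult algebra_simps)

lemma rank_deficient_divide_of_real:
  assumes "rank_deficient A B C D"
  shows "rank_deficient (A / of_real t) (B / of_real t) (C / of_real t) (D / of_real t)"
  using assms by (auto simp: rank_deficient_def norm_divide)

lemma rank_deficient_limit:
  assumes lim: "(A \<longlongrightarrow> A') F" "(B \<longlongrightarrow> B') F" "(C \<longlongrightarrow> C') F" "(D \<longlongrightarrow> D') F"
    and "F \<noteq> bot" and ev: "\<forall>\<^sub>F t in F. rank_deficient (A t) (B t) (C t) (D t)"
  shows "rank_deficient A' B' C' D'"
proof -
  have eq: "p = q" if "(g \<longlongrightarrow> p) F" "(h \<longlongrightarrow> q) F" "\<forall>\<^sub>F t in F. g t = h t"
    for g h :: "_ \<Rightarrow> 'b :: t2_space" and p q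
    using that \<open>F \<noteq> bot\<close> by (metis tendsto_cong tendsto_unique)
  have "norm A' = norm B'" "norm C' = norm D'"
    using ev by (auto intro!: eq[OF tendsto_norm tendsto_norm] lim
        elim!: eventually_mono simp: rank_deficient_def)
  moreover have "C' * cnj B' = cnj D' * A'"
    using ev by (auto intro!: eq[OF tendsto_mult tendsto_mult] tendsto_cnj lim
        elim!: eventually_mono simp: rank_deficient_def)
  ultimately show ?thesis by (simp add: rank_deficient_def)
qed

lemma rank_deficient_unit_factor:
  assumes "rank_deficient A B C D"
  obtains l where "norm l = 1" "A = l * cnj B" "C = l * cnj D"
proof -
  have n: "norm A = norm B" "norm C = norm D" and s: "C * cnj B = cnj D * A"
    using assms by (auto simp: rank_deficient_def)
  consider "B \<noteq> 0" | "B = 0" "D \<noteq> 0" | "B = 0" "D = 0" by blast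
  then show ?thesis
  proof cases
    case 1
    then show ?thesis
      using n s by (intro that[of "A / cnj B"]) (auto simp: norm_divide field_simps)
  next
    case 2
    then show ?thesis
      using n by (intro that[of "C / cnj D"]) (auto simp: norm_divide)
  next
    case 3
    then show ?thesis
      using n by (intro that[of 1]) auto
  qed
qed

lemma not_surj_if_rank_deficient:
  assumes "rank_deficient A B C D"
  shows "\<not> surj (\<lambda>h. A * fst h + B * cnj (fst h) + C * snd h + D * cnj (snd h))"
    (is "\<not> surj ?L")
proof -
  obtain l where l: "norm l = 1" "A = l * cnj B" "C = l * cnj D"
    using rank_deficient_unit_factor[OF assms] .
  \<comment> \<open>With \<open>w\<^sup>2 = - l\<close> every value of the map is real-orthogonal to \<open>w\<close>: up to the factor
     \<open>cnj w\<close>, the two summands in each variable become \<open>x\<close> and \<open>- cnj x\<close>.\<close>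
  define w where "w = csqrt (- l)"
  have w2: "w * w = - l"
    by (simp add: w_def flip: power2_eq_square)
  have w1: "cnj w * w = 1"
    using l(1) by (simp add: w_def complex_norm_square[symmetric] mult.commute)
  have cl: "cnj w * l = - w"
    using w1 w2 by algebra
  have "Re (cnj w * ?L h) = 0" for h
  proof -
    have "cnj w * ?L h = (cnj w * l) * (cnj B * fst h + cnj D * snd h) +
        cnj w * (B * cnj (fst h) + D * cnj (snd h))"
      unfolding l(2,3) by (simp add: algebra_simps)
    also have "\<dots> = cnj w * (B * cnj (fst h) + D * cnj (snd h)) -
        cnj (cnj w * (B * cnj (fst h) + D * cnj (snd h)))"
      unfolding cl by simp
    finally show ?thesis
      by (simp only: minus_complex.sel cnj.sel diff_self)
  qed
  moreover have "Re (cnj w * w) \<noteq> 0"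
    using w1 by simp
  ultimately have "w \<notin> range ?L"
    by blast
  then show ?thesis by blast
qed

lemma critical_point_if_rank_deficient:
  assumes "rank_deficient (mp_eval (d_u f) z) (mp_eval (d_uc f) z)
    (mp_eval (d_v f) z) (mp_eval (d_vc f) z)"
  shows "critical_point (mp_eval f) z"
  unfolding critical_point_def
  using mp_has_derivative not_surj_if_rank_deficient[OF assms] by blast

lemma Sing_rank_deficient:
  assumes "z \<in> Sing f"
  shows "rank_deficient (mp_eval (d_u f) z) (mp_eval (d_uc f) z)
    (mp_eval (d_v f) z) (mp_eval (d_vc f) z)"
  using assms
  by (intro rank_deficientI)
     (simp_all add: Sing_def r_poly_def s_poly_def mp_eval_add mp_eval_diff mp_eval_mult
        mp_eval_cnj)

section \<open>Strongly non-degenerate vectors\<close>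

lemma P_set_subset_A_set: "P_set f \<subseteq> A_set f"
proof (rule subsetI, rule ccontr)
  fix P assume P: "P \<in> P_set f" "P \<notin> A_set f"
  then obtain F G where curve: "curve_in_Sing f P F G"
    and nz: "fps_nth F (fst P) \<noteq> 0" "fps_nth G (snd P) \<noteq> 0"
    by (auto simp: A_set_def P_set_def)
  define a b where "a = fps_nth F (fst P)" and "b = fps_nth G (snd P)"
  define \<gamma> where "\<gamma> = (\<lambda>t::real. (eval_fps F (of_real t), eval_fps G (of_real t)))"
  have lim: "((\<lambda>t. fst (\<gamma> t) / of_real t ^ fst P) \<longlongrightarrow> a) (at_right 0)"
    "((\<lambda>t. snd (\<gamma> t) / of_real t ^ snd P) \<longlongrightarrow> b) (at_right 0)"
    and sing: "\<forall>\<^sub>F t in at_right 0. \<gamma> t \<in> Sing f"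
    using curve_in_Sing_limits[OF curve] by (simp_all add: \<gamma>_def a_def b_def)
  have nonzero: "\<forall>\<^sub>F t in at_right 0. fst (\<gamma> t) \<noteq> 0 \<and> snd (\<gamma> t) \<noteq> 0"
    using tendsto_imp_eventually_ne[OF lim(1), of 0] tendsto_imp_eventually_ne[OF lim(2), of 0] nz
    by (simp add: a_def b_def eventually_conj_iff eventually_mono)
  obtain m where m: "((\<lambda>t. weighted_eval w f (\<gamma> t) / of_real (t ^ m)) \<longlongrightarrow>
      weighted_eval w (face P f) (a, b)) (at_right 0)" for w
    using face_limit[OF lim, of f] by auto
  have "\<forall>\<^sub>F t in at_right 0. rank_deficient
      (weighted_eval (\<lambda>k. fst (fst k)) f (\<gamma> t) / of_real (t ^ m))
      (weighted_eval (\<lambda>k. fst (snd k)) f (\<gamma> t) / of_real (t ^ m))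
      (weighted_eval (\<lambda>k. snd (fst k)) f (\<gamma> t) / of_real (t ^ m))
      (weighted_eval (\<lambda>k. snd (snd k)) f (\<gamma> t) / of_real (t ^ m))"
    using sing nonzero
  proof eventually_elim
    case (elim t)
    then show ?case
      unfolding euler_derivatives[symmetric]
      by (intro rank_deficient_divide_of_real) (simp add: rank_deficient_mult Sing_rank_deficient)
  qed
  from rank_deficient_limit[OF m m m m _ this]
  have "rank_deficient
      (mp_eval (d_u (face P f)) (a, b)) (mp_eval (d_uc (face P f)) (a, b))
      (mp_eval (d_v (face P f)) (a, b)) (mp_eval (d_vc (face P f)) (a, b))"
    unfolding euler_derivatives[symmetric] using nz
    by (simp add: rank_deficient_mult a_def b_def)
  then have "critical_point (mp_eval (face P f)) (a, b)"
    by (rule critical_point_if_rank_deficient)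
  moreover have "(a, b) \<in> Cstar2"
    using nz by (simp add: Cstar2_def a_def b_def)
  ultimately show False
    using P by (auto simp: P_set_def)
qed

theorem theorem1p2:
  fixes f :: mixed_poly
  assumes "mp_eval f (0, 0) = 0"
  shows "(N_set f \<subseteq> A_set f \<longrightarrow> A_set f = Nplus) \<and>
         (N_set f \<subseteq> P_set f \<longrightarrow> A_set f = Nplus)"
proof -
  have "A_set f \<subseteq> Nplus"
    by (auto simp: A_set_def)
  then show ?thesis
    using Nplus_diff_N_set_subset_A_set[of f] P_set_subset_A_set[of f] by blast
qed

end
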